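(* Consider the diagonal solitaire army on the board $\mathbb{Z}^2$: the allowed jumps are all triples $(c,c+d,c+2d)$ with $c\in\mathbb{Z}^2$ and $d\in\{-1,0,1\}^2\setminus\{(0,0)\}$ (a man at $c$ jumps over a man at $c+d$ into the empty cell $c+2d$, and the man at $c+d$ is removed). For $n\ge1$, an army for level $n$ is a finite set $S$ of cells $(x,y)$ all satisfying $y\le -n$, with one man initially placed on each cell of $S$ and all other cells empty; it reaches level $n$ if some finite sequence of legal jumps produces a configuration in which the cell $(0,0)$ is occupied. Then the minimum of $|S|$ over armies reaching level $n$ equals $8,13,23,46,123$ for $n=4,5,6,7,8$ respectively (in particular, armies of these sizes reaching these levels exist, and no smaller army does).
   Context: A jump $(p,q,r)$ is legal in a configuration if $p$ and $q$ are occupied and $r$ is empty; each cell holds at most one man at any time. *)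

theory Defs
  imports Main "HOL-Library.Product_Plus"
begin

type_synonym cell = "int \<times> int"

definition diagonal_jumps :: "(cell \<times> cell \<times> cell) set" where
  "diagonal_jumps = {(c, c + d, c + d + d) | c d. d \<in> {-1, 0, 1} \<times> {-1, 0, 1} - {(0, 0)}}"

text \<open>A configuration is the set of its occupied cells, so a cell holds at most one man.\<close>

definition legal_jump :: "cell set \<Rightarrow> cell \<times> cell \<times> cell \<Rightarrow> bool" where
  "legal_jump C = (\<lambda>(p, q, r). p \<in> C \<and> q \<in> C \<and> r \<notin> C)"

definition make_jump :: "cell set \<Rightarrow> cell \<times> cell \<times> cell \<Rightarrow> cell set" where
  "make_jump C = (\<lambda>(p, q, r). insert r (C - {p, q}))"

definition jump_rel :: "(cell set \<times> cell set) set" where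
  "jump_rel = {(C, make_jump C j) | C j. j \<in> diagonal_jumps \<and> legal_jump C j}"

definition army :: "nat \<Rightarrow> cell set \<Rightarrow> bool" where
  "army n S \<longleftrightarrow> finite S \<and> (\<forall>(x, y) \<in> S. y \<le> - int n)"

text \<open>The army for level \<open>n\<close> starts on or below row \<open>-n\<close>, so the cell to be occupied is the
  origin for every \<open>n\<close>.\<close>

definition reaching_army :: "nat \<Rightarrow> cell set \<Rightarrow> bool" where
  "reaching_army n S \<longleftrightarrow> army n S \<and> (\<exists>C. (S, C) \<in> jump_rel\<^sup>* \<and> (0, 0) \<in> C)"

definition minimum_army_size :: "nat \<Rightarrow> nat \<Rightarrow> bool" where
  "minimum_army_size n m \<longleftrightarrow>
     (\<exists>S. reaching_army n S \<and> card S = m) \<and> (\<forall>S. reaching_army n S \<longrightarrow> m \<le> card S)"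

end

theory Submission
  imports Defs "HOL-Number_Theory.Fib"
begin

text \<open>
  Suppose that the jump which first occupies the origin leads from \<open>p\<close> over \<open>q\<close>.  Just before it,
  both \<open>q\<close> and \<open>p\<close> are occupied.  Give a cell at maximum-norm distance \<open>k\<close> from \<open>q\<close> the weight
  \<open>max 1 (fib (N - k - 1))\<close>; no jump increases the total weight.  As \<open>q\<close> and \<open>p\<close> together weigh
  \<open>fib N\<close>, so does the army at least, and the army has at least \<open>fib N\<close> men minus the total excess
  over weight \<open>1\<close> of all cells on which it may start.  Centring the weight at \<open>q\<close> is essential:
  centred at the origin, it gives too weak a bound.  With the best choice of \<open>N\<close> the bound is
  attained, by games in which every jump preserves the total weight.
\<close>

section \<open>Lower bounds\<close>

definition directions :: "cell set" where
  "directions = {-1, 0, 1} \<times> {-1, 0, 1} - {(0, 0)}"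

lemma jump_rel_iff:
  "(C, D) \<in> jump_rel \<longleftrightarrow> (\<exists>c d. d \<in> directions \<and> c \<in> C \<and> c + d \<in> C \<and> c + d + d \<notin> C \<and>
     D = insert (c + d + d) (C - {c, c + d}))" (is "_ \<longleftrightarrow> ?R")
proof -
  have "(C, D) \<in> jump_rel \<longleftrightarrow> (\<exists>c d. d \<in> directions \<and> legal_jump C (c, c + d, c + d + d) \<and>
    D = make_jump C (c, c + d, c + d + d))"
    unfolding jump_rel_def diagonal_jumps_def directions_def by blast
  also have "\<dots> \<longleftrightarrow> ?R"
    unfolding legal_jump_def make_jump_def prod.case by blast
  finally show ?thesis .
qed

text \<open>Such a \<open>w\<close> is a pagoda function of peg solitaire: a jump trades
  \<open>w c + w (c + d)\<close> for \<open>w (c + d + d)\<close>.\<close>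

lemma sum_jump_le:
  fixes w :: "cell \<Rightarrow> nat"
  assumes pagoda: "\<And>c d. d \<in> directions \<Longrightarrow> w (c + d + d) \<le> w c + w (c + d)"
    and "(C, D) \<in> jump_rel" "finite C"
  shows "finite D \<and> sum w D \<le> sum w C"
proof -
  obtain c d where d: "d \<in> directions"
    and C: "c \<in> C" "c + d \<in> C" "c + d + d \<notin> C"
    and D: "D = insert (c + d + d) (C - {c, c + d})"
    using assms(2) unfolding jump_rel_iff by blast
  have neq: "c \<noteq> c + d"
    using d by (auto simp: directions_def prod_eq_iff)
  have "sum w C = sum w (C - {c, c + d}) + sum w {c, c + d}"
    using C \<open>finite C\<close> by (intro sum.subset_diff) auto
  also have "sum w {c, c + d} = w c + w (c + d)"
    using neq by simp
  finally have "sum w C = sum w (C - {c, c + d}) + (w c + w (c + d))" .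
  moreover have "sum w D = w (c + d + d) + sum w (C - {c, c + d})"
    using D C \<open>finite C\<close> by simp
  ultimately show ?thesis
    using pagoda[OF d, of c] D \<open>finite C\<close> by simp
qed

lemma sum_jumps_le:
  fixes w :: "cell \<Rightarrow> nat"
  assumes pagoda: "\<And>c d. d \<in> directions \<Longrightarrow> w (c + d + d) \<le> w c + w (c + d)"
    and "(C, D) \<in> jump_rel\<^sup>*" "finite C"
  shows "finite D \<and> sum w D \<le> sum w C"
  using assms(2,3)
proof (induction rule: rtrancl_induct)
  case (step D E)
  then show ?case
    using sum_jump_le[OF pagoda step.hyps(2)] by force
qed simp

text \<open>With the weight centred at the jumped cell, the bound needs the configuration just
  before the landing, where \<open>c\<close> and \<open>c + d\<close> are both still
  occupied.\<close>

lemma landing_jump: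
  assumes "(S, C) \<in> jump_rel\<^sup>*" "z \<in> C" "z \<notin> S"
  shows "\<exists>D c d. (S, D) \<in> jump_rel\<^sup>* \<and> d \<in> directions \<and> c \<in> D \<and> c + d \<in> D \<and> c + d + d = z"
  using assms
proof (induction rule: rtrancl_induct)
  case (step D E)
  show ?case
  proof (cases "z \<in> D")
    case False
    then show ?thesis
      using step.hyps step.prems unfolding jump_rel_iff by blast
  qed (use step in blast)
qed simp

section \<open>The Fibonacci weight\<close>

definition cell_norm :: "cell \<Rightarrow> nat" where
  "cell_norm c = nat (max \<bar>fst c\<bar> \<bar>snd c\<bar>)"

text \<open>The maximum with \<open>1\<close> makes the weight of every man at least its cost, so that only the
  finitely many cells with a larger weight matter.\<close>

definition fib_weight :: "nat \<Rightarrow> cell \<Rightarrow> nat" where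
  "fib_weight N c = max 1 (fib (N - Suc (cell_norm c)))"

text \<open>This is the Fibonacci recurrence while \<open>k + 2 \<le> N\<close>; beyond that,
  truncated subtraction leaves 1 on the left and at least 2 on the right.\<close>

lemma fib_diff_le: "max 1 (fib (N - k)) \<le> max 1 (fib (N - Suc k)) + max 1 (fib (N - Suc (Suc k)))"
proof (cases "Suc (Suc k) \<le> N")
  case True
  then obtain m where "N = Suc (Suc (k + m))"
    by (metis add_Suc le_iff_add)
  then show ?thesis
    by (auto simp: max_def)
next
  case False
  then have "N - k = 0 \<or> N - k = 1"
    by linarith
  then show ?thesis
    by auto
qed

lemma cell_norm_add_direction:
  assumes "d \<in> directions"
  shows "cell_norm c \<le> Suc (cell_norm (c + d))"
proof -
  have "\<bar>fst d\<bar> \<le> 1" "\<bar>snd d\<bar> \<le> 1"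
    using assms unfolding directions_def by auto
  then show ?thesis
    unfolding cell_norm_def fst_add snd_add by linarith
qed

text \<open>A unit step, diagonal or not, approaches the centre by at most one, so
  \<open>c + d\<close> and \<open>c\<close> are at most one and two further out than the landing
  cell. As \<open>fib\<close> is monotone, the recurrence suffices.\<close>

lemma fib_weight_pagoda:
  assumes "d \<in> directions"
  shows "fib_weight N (c + d + d) \<le> fib_weight N c + fib_weight N (c + d)"
proof -
  let ?k = "cell_norm (c + d + d)"
  have "cell_norm (c + d) \<le> Suc ?k" "cell_norm c \<le> Suc (Suc ?k)"
    using cell_norm_add_direction[OF assms, of "c + d"] cell_norm_add_direction[OF assms, of c]
    by auto
  then have "fib (N - Suc (Suc ?k)) \<le> fib (N - Suc (cell_norm (c + d)))"
    "fib (N - Suc (Suc (Suc ?k))) \<le> fib (N - Suc (cell_norm c))"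
    by (auto intro!: fib_mono)
  then have "max 1 (fib (N - Suc (Suc ?k))) \<le> fib_weight N (c + d)"
    "max 1 (fib (N - Suc (Suc (Suc ?k)))) \<le> fib_weight N c"
    unfolding fib_weight_def by auto
  then show ?thesis
    using fib_diff_le[of N "Suc ?k"] unfolding fib_weight_def by linarith
qed

lemma fib_weight_eq_1:
  assumes "N \<le> cell_norm c + 3"
  shows "fib_weight N c = 1"
proof -
  have "fib (N - Suc (cell_norm c)) \<le> fib 2"
    using assms by (intro fib_mono) linarith
  then show ?thesis
    unfolding fib_weight_def by (simp add: numeral_2_eq_2)
qed

text \<open>The coordinates are relative to the cell \<open>q\<close>, which is never below row \<open>-1\<close>.\<close>

definition excess :: "nat \<Rightarrow> nat \<Rightarrow> nat" where
  "excess n N =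
    (\<Sum>c \<in> {- int N + 4..int N - 4} \<times> {- int N + 4..1 - int n}. fib_weight N c - 1)"

lemma reaching_army_card_ge:
  assumes "reaching_army n S" "n \<ge> 1" "N \<ge> 2"
  shows "fib N \<le> card S + excess n N"
proof -
  let ?e = "\<lambda>c. fib_weight N c - 1"
  let ?B = "{- int N + 4..int N - 4} \<times> {- int N + 4..1 - int n}"
  obtain C where C: "finite S" "\<forall>(x, y)\<in>S. y \<le> - int n" "(S, C) \<in> jump_rel\<^sup>*" "(0, 0) \<in> C"
    using assms(1) unfolding reaching_army_def army_def by blast
  have "(0, 0) \<notin> S"
    using C(2) assms(2) by auto
  then obtain D c d where D: "(S, D) \<in> jump_rel\<^sup>*" "d \<in> directions" "c \<in> D" "c + d \<in> D"
    "c + d + d = (0, 0)"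
    using landing_jump[OF C(3,4)] by blast
  define q where "q = c + d"
  define w where "w = (\<lambda>a. fib_weight N (a - q))"
  have pagoda: "w (a + b + b) \<le> w a + w (a + b)" if "b \<in> directions" for a b
    using fib_weight_pagoda[OF that, of N "a - q"] by (simp add: w_def algebra_simps)
  have fin: "finite D" and le: "sum w D \<le> sum w S"
    using sum_jumps_le[of w, OF pagoda D(1) C(1)] by auto
  have q: "q = - d" and c: "c - q = - d"
    using D(5) by (auto simp: q_def prod_eq_iff)
  have "c \<noteq> q"
    using D(2) by (auto simp: directions_def q_def prod_eq_iff)
  have norms: "cell_norm (q - q) = 0" "cell_norm (c - q) = 1"
    using D(2) unfolding c by (auto simp: directions_def cell_norm_def)
  have "N = Suc (Suc (N - 2))"
    using assms(3) by simp
  then have "fib N = fib (N - 1) + fib (N - 2)"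
    by (metis diff_Suc_1 fib.simps(3))
  also have "\<dots> \<le> w q + w c"
    unfolding w_def fib_weight_def norms by (auto simp: numeral_2_eq_2)
  also have "\<dots> = sum w {q, c}"
    using \<open>c \<noteq> q\<close> by auto
  also have "\<dots> \<le> sum w D"
    using D(3,4) fin by (intro sum_mono2) (auto simp: q_def)
  also have "\<dots> \<le> sum w S"
    by (fact le)
  \<comment> \<open>Every weight is at least 1, so the natural subtraction in \<open>?e\<close>
    loses nothing.\<close>
  also have "\<dots> = (\<Sum>a\<in>S. 1 + ?e (a - q))"
    unfolding w_def by (intro sum.cong) (auto simp: fib_weight_def)
  also have "\<dots> = card S + (\<Sum>a\<in>S. ?e (a - q))"
    unfolding sum.distrib by simp
  also have "(\<Sum>a\<in>S. ?e (a - q)) = sum ?e ((\<lambda>a. a - q) ` S)"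
    by (subst sum.reindex) (auto simp: inj_on_def)
  also have "\<dots> = sum ?e ((\<lambda>a. a - q) ` S \<inter> ?B)"
  proof (rule sum.mono_neutral_right)
    show "\<forall>a \<in> (\<lambda>a. a - q) ` S - (\<lambda>a. a - q) ` S \<inter> ?B. ?e a = 0"
    proof
      fix a assume a: "a \<in> (\<lambda>a. a - q) ` S - (\<lambda>a. a - q) ` S \<inter> ?B"
      \<comment> \<open>As \<open>q = - d\<close> is on row -1 or higher, recentring raises a row by
        at most one.\<close>
      then have "snd a \<le> 1 - int n"
        using C(2) D(2) unfolding q directions_def by fastforce
      moreover have "a \<notin> ?B"
        using a by blast
      \<comment> \<open>From norm \<open>N - 3\<close> on, the weight is 1; hence the margin 4 in
        \<open>?B\<close>.\<close>
      ultimately have "N \<le> cell_norm a + 3"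
        by (cases a) (auto simp: cell_norm_def)
      then show "?e a = 0"
        by (simp add: fib_weight_eq_1)
    qed
    show "finite ((\<lambda>a. a - q) ` S)"
      using C(1) by (rule finite_imageI)
  qed (rule Int_lower1)
  also have "\<dots> \<le> sum ?e ?B"
    by (rule sum_mono2) (simp_all only: finite_cartesian_product finite_atLeastAtMost_int Int_lower2 zero_le)
  finally show ?thesis
    by (simp add: excess_def)
qed

section \<open>Armies of minimum size\<close>

text \<open>A game is recorded backwards from the single man at the origin, so that its starting army is
  computed.  An entry \<open>(r, d)\<close> takes back the jump in direction \<open>d\<close> that landed on \<open>r\<close>.\<close>

fun take_back :: "(cell \<times> cell) list \<Rightarrow> cell list \<Rightarrow> cell list option" where
  "take_back [] cs = Some cs"
| "take_back ((r, d) # js) cs =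
    (let q = r - d; p = q - d in
      if d \<in> directions \<and> r \<in> set cs \<and> q \<notin> set cs \<and> p \<notin> set cs
      then take_back js (p # q # removeAll r cs) else None)"

text \<open>The tests in \<open>take_back\<close> describe what a jump leaves behind:
  \<open>r\<close> occupied, \<open>p\<close> and \<open>q\<close> empty. Restoring the two men
  therefore gives a position in which the jump is legal.\<close>

lemma take_back_jumps:
  assumes "take_back js cs = Some bs" "distinct cs"
  shows "distinct bs \<and> (set bs, set cs) \<in> jump_rel\<^sup>*"
  using assms
proof (induction js cs rule: take_back.induct)
  case (2 r d js cs)
  define q p where "q = r - d" and "p = q - d"
  have ok: "d \<in> directions" "r \<in> set cs" "q \<notin> set cs" "p \<notin> set cs"
    and rest: "take_back js (p # q # removeAll r cs) = Some bs"
    using "2.prems"(1) unfolding q_def p_def by (auto simp: Let_def split: if_splits)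
  have pq: "q = p + d" "r = p + d + d" "p \<noteq> q" "r \<noteq> p" "r \<noteq> q"
    using ok unfolding q_def p_def by (auto simp: directions_def prod_eq_iff)
  have "distinct bs \<and> (set bs, set (p # q # removeAll r cs)) \<in> jump_rel\<^sup>*"
    using "2.IH"[OF refl refl] ok rest pq(3) "2.prems"(2)
    unfolding q_def p_def by (simp add: distinct_removeAll)
  moreover have "set cs = insert r (set (p # q # removeAll r cs) - {p, q})"
    "r \<notin> set (p # q # removeAll r cs)"
    using ok pq by auto
  then have "(set (p # q # removeAll r cs), set cs) \<in> jump_rel"
    unfolding jump_rel_iff using ok(1) pq(1,2)
    by (intro exI[of _ p] exI[of _ d]) (metis list.set_intros)
  ultimately show ?case
    by (meson rtrancl.rtrancl_into_rtrancl)
qed simp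

text \<open>The computed list is distinct, so its length counts the men.\<close>

definition valid_record :: "nat \<Rightarrow> nat \<Rightarrow> (cell \<times> cell) list \<Rightarrow> bool" where
  "valid_record n m js \<longleftrightarrow> (case take_back js [(0, 0)] of None \<Rightarrow> False
    | Some cs \<Rightarrow> length cs = m \<and> list_all (\<lambda>c. snd c \<le> - int n) cs)"

text \<open>The parameter \<open>N\<close> is free, and is chosen per level so that the recorded
  game meets the bound exactly.\<close>

lemma minimum_army_sizeI:
  assumes "valid_record n m js" "n \<ge> 1" "N \<ge> 2"
    and "fib N = m + excess n N"
  shows "minimum_army_size n m"
proof -
  obtain cs where cs: "take_back js [(0, 0)] = Some cs" "length cs = m"
    "list_all (\<lambda>c. snd c \<le> - int n) cs"
    using assms(1) unfolding valid_record_def by (auto split: option.splits)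
  have "distinct cs" "(set cs, {(0, 0)}) \<in> jump_rel\<^sup>*"
    using take_back_jumps[OF cs(1)] by auto
  then have "reaching_army n (set cs)" "card (set cs) = m"
    using cs unfolding reaching_army_def army_def list_all_iff
    by (auto simp: distinct_card case_prod_unfold)
  moreover have "m \<le> card S" if "reaching_army n S" for S
    using reaching_army_card_ge[OF that assms(2,3)] assms(4) by linarith
  ultimately show ?thesis
    unfolding minimum_army_size_def by blast
qed

definition game_4 :: "(cell \<times> cell) list" where
  "game_4 =
   [((0, 0), (-1, 1)), ((1, -1), (1, 1)), ((0, -2), (0, 1)), ((-1, -3), (0, 1)),
    ((2, -2), (-1, 1)), ((3, -3), (1, 1)), ((0, -3), (-1, 1))]"

lemma minimum_army_size_4: "minimum_army_size 4 8"
proof (rule minimum_army_sizeI)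
  show "valid_record 4 8 game_4"
    by code_simp
  \<comment> \<open>Here, as for level 5, the box in \<open>excess\<close> is empty and the bound is
    \<open>fib N\<close> itself.\<close>
  show "fib 6 = 8 + excess 4 6"
    by code_simp
qed simp_all

definition game_5 :: "(cell \<times> cell) list" where
  "game_5 =
   [((0, 0), (-1, 1)), ((2, -2), (-1, 1)), ((4, -4), (0, 1)), ((1, -1), (1, 1)),
    ((3, -3), (-1, 1)), ((-1, -3), (-1, 1)), ((0, -2), (1, 1)), ((0, -4), (0, 1)),
    ((-1, -3), (0, 1)), ((-1, -4), (1, 1)), ((-2, -4), (1, 1)), ((4, -4), (1, 1))]"

lemma minimum_army_size_5: "minimum_army_size 5 13"
proof (rule minimum_army_sizeI)
  show "valid_record 5 13 game_5"
    by code_simp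
  show "fib 7 = 13 + excess 5 7"
    by code_simp
qed simp_all

text \<open>From here on the box is nonempty, and equality forces the army to fill it. The first
  entry, the final jump, goes upwards over \<open>(1, -1)\<close>, which centres the box
  there.\<close>

definition game_6 :: "(cell \<times> cell) list" where
  "game_6 =
   [((0, 0), (-1, 1)), ((1, -1), (1, 1)), ((-1, -3), (0, 1)), ((2, -2), (-1, 1)),
    ((-1, -5), (1, 1)), ((4, -4), (0, 1)), ((0, -2), (1, 1)), ((-1, -4), (-1, 1)),
    ((-2, -4), (1, 1)), ((-1, -3), (0, 1)), ((4, -5), (-1, 1)), ((-4, -6), (1, 0)),
    ((-1, -4), (1, 1)), ((-3, -6), (-1, 1)), ((3, -3), (-1, 1)), ((5, -5), (-1, 1)),
    ((-2, -5), (1, 1)), ((0, -5), (0, 1)), ((-1, -5), (0, 1)), ((-3, -5), (1, 1)),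
    ((4, -4), (1, 1)), ((3, -5), (0, 1))]"

lemma minimum_army_size_6: "minimum_army_size 6 23"
proof (rule minimum_army_sizeI)
  show "valid_record 6 23 game_6"
    by code_simp
  \<comment> \<open>The box is a single row of eleven cells of weight 2: 34 = 23 + 11.\<close>
  show "fib 9 = 23 + excess 6 9"
    by code_simp
qed simp_all

definition game_7 :: "(cell \<times> cell) list" where
  "game_7 =
   [((0, 0), (-1, 1)), ((2, -2), (-1, 1)), ((1, -1), (1, 1)), ((4, -4), (-1, 1)),
    ((0, -2), (0, 1)), ((0, -3), (1, 1)), ((5, -5), (0, 1)), ((-1, -4), (-1, 1)),
    ((3, -3), (-1, 1)), ((5, -7), (0, 1)), ((6, -6), (0, 1)), ((5, -5), (-1, 1)),
    ((5, -8), (-1, 1)), ((-1, -3), (1, 1)), ((-2, -4), (-1, 1)), ((1, -6), (1, 1)),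
    ((5, -6), (1, 1)), ((0, -6), (1, 1)), ((-3, -5), (1, 1)), ((4, -7), (0, 1)),
    ((0, -7), (-1, 1)), ((-2, -8), (1, 1)), ((-2, -5), (1, 1)), ((0, -4), (-1, 1)),
    ((4, -8), (1, 1)), ((-5, -7), (1, 0)), ((6, -7), (-1, 1)), ((-4, -6), (1, 1)),
    ((-4, -7), (-1, 1)), ((1, -8), (1, 1)), ((-1, -5), (1, 1)), ((-3, -7), (-1, 1)),
    ((-3, -6), (1, 1)), ((2, -6), (0, 1)), ((0, -5), (1, 1)), ((1, -5), (-1, 1)),
    ((-1, -6), (-1, 1)), ((4, -4), (0, 1)), ((7, -7), (-1, 0)), ((6, -6), (-1, 1)),
    ((2, -6), (1, 1)), ((-2, -6), (1, 1)), ((4, -6), (0, 1)), ((4, -5), (-1, 1)),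
    ((5, -6), (0, 1))]"

lemma minimum_army_size_7: "minimum_army_size 7 46"
proof (rule minimum_army_sizeI)
  show "valid_record 7 46 game_7"
    by code_simp
  show "fib 11 = 46 + excess 7 11"
    by code_simp
qed simp_all

definition game_8 :: "(cell \<times> cell) list" where
  "game_8 =
   [((0, 0), (-1, 1)), ((1, -1), (1, 1)), ((-1, -3), (1, 1)), ((-3, -5), (1, 1)),
    ((2, -2), (-1, 1)), ((4, -4), (-1, 1)), ((-5, -7), (1, 1)), ((6, -6), (-1, 0)),
    ((0, -2), (-1, 1)), ((5, -5), (-1, 1)), ((-6, -8), (1, 0)), ((2, -4), (0, 1)),
    ((3, -3), (-1, 1)), ((-4, -6), (1, 1)), ((1, -3), (0, 1)), ((2, -5), (1, 1)),
    ((5, -5), (0, 1)), ((7, -7), (0, 1)), ((0, -7), (0, 1)), ((-2, -4), (1, 1)),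
    ((0, -9), (0, 1)), ((5, -6), (1, 1)), ((-7, -9), (1, 1)), ((-7, -8), (1, 1)),
    ((1, -5), (1, 1)), ((7, -8), (-1, 1)), ((-8, -8), (1, 0)), ((7, -6), (-1, 1)),
    ((4, -7), (-1, 1)), ((0, -8), (-1, 1)), ((1, -6), (1, 1)), ((0, -7), (0, 1)),
    ((1, -4), (1, 1)), ((-6, -8), (1, 0)), ((2, -10), (0, 1)), ((-5, -7), (1, 1)),
    ((8, -9), (0, 1)), ((-6, -8), (0, 1)), ((-1, -6), (-1, 1)), ((-4, -6), (1, 1)),
    ((1, -9), (-1, 1)), ((0, -5), (1, 1)), ((9, -8), (-1, 1)), ((-1, -7), (1, 1)),
    ((8, -10), (1, 1)), ((6, -9), (0, 1)), ((7, -11), (0, 1)), ((-2, -8), (0, 1)),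
    ((-2, -10), (1, 1)), ((8, -6), (-1, 1)), ((4, -4), (0, 1)), ((2, -10), (1, 1)),
    ((4, -5), (-1, 1)), ((2, -11), (1, 1)), ((-8, -9), (1, 0)), ((-9, -11), (0, 1)),
    ((6, -7), (0, 1)), ((0, -8), (-1, 1)), ((-3, -11), (-1, 1)), ((0, -9), (-1, 1)),
    ((2, -6), (0, 1)), ((0, -6), (1, 1)), ((-6, -10), (1, 1)), ((0, -7), (0, 1)),
    ((-7, -9), (-1, 1)), ((9, -10), (-1, 1)), ((-3, -9), (0, 1)), ((0, -11), (1, 1)),
    ((5, -6), (-1, 1)), ((-8, -10), (1, 1)), ((-6, -8), (1, 1)), ((8, -11), (-1, 1)),
    ((-2, -7), (1, 1)), ((11, -10), (-1, -1)), ((3, -8), (0, 1)), ((7, -8), (-1, 1)),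
    ((8, -9), (0, 1)), ((-2, -8), (1, 1)), ((-9, -9), (1, 1)), ((10, -8), (-1, 0)),
    ((-3, -5), (0, 1)), ((6, -9), (1, 1)), ((6, -6), (-1, 1)), ((-1, -8), (0, 1)),
    ((-3, -6), (1, 1)), ((6, -10), (-1, 1)), ((-7, -9), (1, 0)), ((4, -11), (1, 1)),
    ((-5, -7), (1, 1)), ((8, -8), (-1, 1)), ((10, -10), (-1, 1)), ((-1, -10), (1, 1)),
    ((-3, -10), (1, 1)), ((8, -10), (-1, 1)), ((3, -9), (-1, 1)), ((5, -11), (1, 1)),
    ((10, -9), (-1, 1)), ((7, -9), (1, 1)), ((-4, -9), (1, 1)), ((-5, -8), (-1, 1)),
    ((9, -7), (-1, 1)), ((-2, -9), (-1, 1)), ((6, -8), (-1, 1)), ((-6, -9), (1, 1)),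
    ((-4, -7), (1, 1)), ((11, -11), (-1, -1)), ((5, -8), (-1, 1)), ((-3, -9), (-1, 1)),
    ((9, -9), (-1, 1)), ((-1, -7), (1, 1)), ((8, -7), (-1, 1)), ((5, -7), (0, 1)),
    ((4, -6), (-1, 1)), ((3, -10), (-1, 1)), ((5, -7), (1, 1)), ((1, -8), (-1, 1)),
    ((-1, -6), (-1, 1)), ((2, -7), (-1, 1)), ((6, -7), (-1, 1)), ((7, -7), (-1, 1)),
    ((-3, -7), (1, 1)), ((0, -7), (1, 1))]"

lemma minimum_army_size_8: "minimum_army_size 8 123"
proof (rule minimum_army_sizeI)
  show "valid_record 8 123 game_8"
    by code_simp
  \<comment> \<open>The box now has four rows, with total excess 254 = 377 - 123.\<close>
  show "fib 14 = 123 + excess 8 14"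
    by code_simp
qed simp_all

theorem theorem1:
  shows "minimum_army_size 4 8 \<and> minimum_army_size 5 13 \<and> minimum_army_size 6 23 \<and>
         minimum_army_size 7 46 \<and> minimum_army_size 8 123"
  using minimum_army_size_4 minimum_army_size_5 minimum_army_size_6 minimum_army_size_7
    minimum_army_size_8 by blast

end
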